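(* Let $M$ be a $G$-graded $R$-module, $N\leq_G M$ and $I\lhd_G R$. Then: (1) $V_G^s(Ann_M(I))=V_G^s(Ann_M(Gr(I)))=V_G^{s*}(Ann_M(I))=V_G^{s*}(Ann_M(Gr(I)))$. (2) $V_G^s(N)=V_G^s(Ann_M(Ann_R(N)))=V_G^s(Ann_M(Gr(Ann_R(N))))=V_G^{s*}(Ann_M(Ann_R(N)))=V_G^{s*}(Ann_M(Gr(Ann_R(N))))$.
   Context: $G$ is an abelian group with identity $e$; all rings are commutative with unity $1$. A $G$-graded ring is a ring $R=\bigoplus_{g\in G}R_g$ with additive subgroups $R_g$ satisfying $R_gR_h\subseteq R_{gh}$; $h(R)=\bigcup_{g}R_g$. An ideal $I$ is graded ($I\lhd_G R$) if $I=\bigoplus_g (I\cap R_g)$. The graded radical $Gr(I)$ of $I\lhd_G R$ is the set of all $a=\sum_g a_g\in R$ (with $a_g\in R_g$) such that for each $g$ there is $n_g>0$ with $a_g^{n_g}\in I$. A $G$-graded $R$-module is an $R$-module $M=\bigoplus_{g\in G}M_g$ with $R_gM_h\subseteq M_{gh}$; a submodule $N$ is graded ($N\leq_G M$) if $N=\bigoplus_g(N\cap M_g)$. $Ann_R(N)=\{r\in R: rN=0\}$ and $Ann_M(I)=\{m\in M: Im=0\}$. A non-zero graded submodule $S$ of $M$ is graded second if for every $r\in h(R)$, $rS=S$ or $rS=0$; $\mathrm{Spec}_G^s(M)$ is the set of all graded second submodules of $M$. For $N\leq_G M$: $V_G^{s*}(N)=\{S\in\mathrm{Spec}_G^s(M):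 S\subseteq N\}$ and $V_G^s(N)=\{S\in \mathrm{Spec}_G^s(M): Ann_R(N)\subseteq Ann_R(S)\}$. *)

theory Defs
  imports "HOL-Algebra.Algebra"
begin

text \<open>
  \<open>f\<close> lists the components of \<open>x\<close> in the family \<open>D\<close>. Only the finitely many nonzero components are
  summed, since \<^const>\<open>finsum\<close> is meaningful only on finite index sets; outside \<open>I\<close> the function
  \<open>f\<close> is pinned to \<^const>\<open>undefined\<close>, so that uniqueness of \<open>f\<close> is uniqueness of the components.
\<close>

definition components_of ::
  "('a, 'm) ring_scheme \<Rightarrow> 'i set \<Rightarrow> ('i \<Rightarrow> 'a set) \<Rightarrow> ('i \<Rightarrow> 'a) \<Rightarrow> 'a \<Rightarrow> bool"
  where
  "components_of A I D f x \<longleftrightarrow>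
     f \<in> (\<Pi>\<^sub>E i\<in>I. D i) \<and> finite {i \<in> I. f i \<noteq> \<zero>\<^bsub>A\<^esub>} \<and>
     x = (\<Oplus>\<^bsub>A\<^esub>i\<in>{i \<in> I. f i \<noteq> \<zero>\<^bsub>A\<^esub>}. f i)"

text \<open>The internal direct sum \<open>B = \<Oplus>\<^sub>i D\<^sub>i\<close> of subgroups of the additive group of \<open>A\<close>.\<close>

definition internal_direct_sum ::
  "('a, 'm) ring_scheme \<Rightarrow> 'i set \<Rightarrow> ('i \<Rightarrow> 'a set) \<Rightarrow> 'a set \<Rightarrow> bool"
  where
  "internal_direct_sum A I D B \<longleftrightarrow>
     additive_subgroup B A \<and>
     (\<forall>i\<in>I. additive_subgroup (D i) A \<and> D i \<subseteq> B) \<and>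
     (\<forall>x\<in>B. \<exists>!f. components_of A I D f x)"

locale graded_ring = G?: comm_group G + R?: cring R
  for G :: "('g, 'n) monoid_scheme" (structure) and R :: "('a, 'm) ring_scheme" (structure) +
  fixes RG :: "'g \<Rightarrow> 'a set"
  assumes ring_direct_sum: "internal_direct_sum R (carrier G) RG (carrier R)"
    and ring_degree_mult:
      "\<lbrakk>g \<in> carrier G; h \<in> carrier G; x \<in> RG g; y \<in> RG h\<rbrakk>
         \<Longrightarrow> x \<otimes>\<^bsub>R\<^esub> y \<in> RG (g \<otimes>\<^bsub>G\<^esub> h)"

locale graded_module = graded_ring G R RG + module R M
  for G :: "('g, 'n) monoid_scheme" (structure) and R :: "('a, 'm) ring_scheme" (structure)
    and RG :: "'g \<Rightarrow> 'a set" and M :: "('a, 'b, 'p) module_scheme" (structure) +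
  fixes MG :: "'g \<Rightarrow> 'b set"
  assumes module_direct_sum: "internal_direct_sum M (carrier G) MG (carrier M)"
    and module_degree_smult:
      "\<lbrakk>g \<in> carrier G; h \<in> carrier G; r \<in> RG g; x \<in> MG h\<rbrakk>
         \<Longrightarrow> r \<odot>\<^bsub>M\<^esub> x \<in> MG (g \<otimes>\<^bsub>G\<^esub> h)"

definition homogeneous :: "('g, 'n) monoid_scheme \<Rightarrow> ('g \<Rightarrow> 'a set) \<Rightarrow> 'a set" where
  "homogeneous G RG = (\<Union>g\<in>carrier G. RG g)"

definition graded_ideal ::
  "('g, 'n) monoid_scheme \<Rightarrow> ('a, 'm) ring_scheme \<Rightarrow> ('g \<Rightarrow> 'a set) \<Rightarrow> 'a set \<Rightarrow> bool"
  where
  "graded_ideal G R RG J \<longleftrightarrow>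
     ideal J R \<and> internal_direct_sum R (carrier G) (\<lambda>g. J \<inter> RG g) J"

definition graded_submodule ::
  "('g, 'n) monoid_scheme \<Rightarrow> ('a, 'm) ring_scheme \<Rightarrow> ('a, 'b, 'p) module_scheme \<Rightarrow>
     ('g \<Rightarrow> 'b set) \<Rightarrow> 'b set \<Rightarrow> bool"
  where
  "graded_submodule G R M MG N \<longleftrightarrow>
     submodule N R M \<and> internal_direct_sum M (carrier G) (\<lambda>g. N \<inter> MG g) N"

text \<open>The components of \<open>a\<close> are unique in a graded ring, so the existential only names them.\<close>

definition graded_radical ::
  "('g, 'n) monoid_scheme \<Rightarrow> ('a, 'm) ring_scheme \<Rightarrow> ('g \<Rightarrow> 'a set) \<Rightarrow> 'a set \<Rightarrow> 'a set"
  where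
  "graded_radical G R RG J =
     {a \<in> carrier R. \<exists>f. components_of R (carrier G) RG f a \<and>
        (\<forall>g\<in>carrier G. \<exists>n::nat. n > 0 \<and> f g [^]\<^bsub>R\<^esub> n \<in> J)}"

definition ann_ring ::
  "('a, 'm) ring_scheme \<Rightarrow> ('a, 'b, 'p) module_scheme \<Rightarrow> 'b set \<Rightarrow> 'a set"
  where
  "ann_ring R M N = {r \<in> carrier R. \<forall>x\<in>N. r \<odot>\<^bsub>M\<^esub> x = \<zero>\<^bsub>M\<^esub>}"

definition ann_module :: "('a, 'b, 'p) module_scheme \<Rightarrow> 'a set \<Rightarrow> 'b set" where
  "ann_module M J = {x \<in> carrier M. \<forall>r\<in>J. r \<odot>\<^bsub>M\<^esub> x = \<zero>\<^bsub>M\<^esub>}"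

definition graded_second ::
  "('g, 'n) monoid_scheme \<Rightarrow> ('a, 'm) ring_scheme \<Rightarrow> ('g \<Rightarrow> 'a set) \<Rightarrow>
     ('a, 'b, 'p) module_scheme \<Rightarrow> ('g \<Rightarrow> 'b set) \<Rightarrow> 'b set \<Rightarrow> bool"
  where
  "graded_second G R RG M MG S \<longleftrightarrow>
     graded_submodule G R M MG S \<and> S \<noteq> {\<zero>\<^bsub>M\<^esub>} \<and>
     (\<forall>r\<in>homogeneous G RG.
        (\<lambda>x. r \<odot>\<^bsub>M\<^esub> x) ` S = S \<or> (\<lambda>x. r \<odot>\<^bsub>M\<^esub> x) ` S = {\<zero>\<^bsub>M\<^esub>})"

definition second_spec ::
  "('g, 'n) monoid_scheme \<Rightarrow> ('a, 'm) ring_scheme \<Rightarrow> ('g \<Rightarrow> 'a set) \<Rightarrow>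
     ('a, 'b, 'p) module_scheme \<Rightarrow> ('g \<Rightarrow> 'b set) \<Rightarrow> 'b set set"
  where
  "second_spec G R RG M MG = {S. graded_second G R RG M MG S}"

text \<open>\<open>V\<^sup>s\<^sup>*\<^sub>G(N)\<close>\<close>

definition Vs_star ::
  "('g, 'n) monoid_scheme \<Rightarrow> ('a, 'm) ring_scheme \<Rightarrow> ('g \<Rightarrow> 'a set) \<Rightarrow>
     ('a, 'b, 'p) module_scheme \<Rightarrow> ('g \<Rightarrow> 'b set) \<Rightarrow> 'b set \<Rightarrow> 'b set set"
  where
  "Vs_star G R RG M MG N = {S \<in> second_spec G R RG M MG. S \<subseteq> N}"

text \<open>\<open>V\<^sup>s\<^sub>G(N)\<close>\<close>

definition Vs ::
  "('g, 'n) monoid_scheme \<Rightarrow> ('a, 'm) ring_scheme \<Rightarrow> ('g \<Rightarrow> 'a set) \<Rightarrow>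
     ('a, 'b, 'p) module_scheme \<Rightarrow> ('g \<Rightarrow> 'b set) \<Rightarrow> 'b set \<Rightarrow> 'b set set"
  where
  "Vs G R RG M MG N =
     {S \<in> second_spec G R RG M MG. ann_ring R M N \<subseteq> ann_ring R M S}"

end

theory Submission
  imports Defs
begin

text \<open>
  For an arbitrary set \<open>J\<close> of scalars, both \<open>V\<^sup>s\<^sub>G(Ann\<^sub>M(J))\<close> and \<open>V\<^sup>s\<^sup>*\<^sub>G(Ann\<^sub>M(J))\<close> consist of
  the graded second submodules \<open>S\<close> with \<open>J \<subseteq> Ann\<^sub>R(S)\<close>. If \<open>J\<close> contains the homogeneous components
  of its elements, this condition does not change when \<open>J\<close> is replaced by \<open>Gr(J)\<close>: a homogeneous
  \<open>r\<close> with \<open>r\<^sup>n S = 0\<close> cannot satisfy \<open>r S = S\<close>, so \<open>r S = 0\<close>. The annihilator of a graded submodule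
  contains the components of its elements because the terms \<open>r\<^sub>g x\<close> of \<open>r x\<close>, for homogeneous \<open>x\<close>,
  lie in distinct degrees.
\<close>

section \<open>Components in an internal direct sum and the graded radical\<close>

lemma internal_direct_sum_component_unique:
  assumes "internal_direct_sum A I D B" "x \<in> B"
    and "components_of A I D f x" "components_of A I D f' x"
  shows "f = f'"
  using assms unfolding internal_direct_sum_def by blast

lemma internal_direct_sum_obtain_components:
  assumes "internal_direct_sum A I D B" "x \<in> B"
  obtains f where "components_of A I D f x"
  using assms unfolding internal_direct_sum_def by blast

text \<open>Serves to read the decomposition of an element of a graded ideal or submodule as its
  decomposition in the ambient ring or module.\<close>

lemma components_of_mono:
  assumes "components_of A I D f x" "\<And>i. i \<in> I \<Longrightarrow> D i \<subseteq> E i"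
  shows "components_of A I E f x"
  using assms unfolding components_of_def by (auto simp: PiE_iff)

lemma components_of_mem:
  assumes "components_of A I D f x" "i \<in> I"
  shows "f i \<in> D i"
  using assms unfolding components_of_def by auto

text \<open>Membership in the graded radical tests the components of \<open>a\<close>, not
  \<open>a\<close> itself, so these must lie in \<open>J\<close> as well; then exponent 1 works for
  each of them.\<close>

lemma graded_radical_superset:
  assumes "J \<subseteq> carrier R"
    and "\<And>a. a \<in> J \<Longrightarrow>
      \<exists>f. components_of R (carrier G) RG f a \<and> (\<forall>g\<in>carrier G. f g \<in> J \<inter> carrier R)"
    and "monoid R"
  shows "J \<subseteq> graded_radical G R RG J"
proof
  fix a assume a: "a \<in> J"
  obtain f where f: "components_of R (carrier G) RG f a"
    and fJ: "\<And>g. g \<in> carrier G \<Longrightarrow> f g \<in> J \<inter> carrier R"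
    using assms(2)[OF a] by blast
  have "f g [^]\<^bsub>R\<^esub> (1::nat) \<in> J" if "g \<in> carrier G" for g
    using fJ[OF that] monoid.nat_pow_eone[OF assms(3)] by auto
  then show "a \<in> graded_radical G R RG J"
    using a assms(1) f unfolding graded_radical_def by (blast intro: zero_less_one)
qed

section \<open>Scalars acting on finite sums and on images\<close>

lemma (in module) finsum_smult_rdistr:
  assumes "finite A" "f \<in> A \<rightarrow> carrier R" "x \<in> carrier M"
  shows "(\<Oplus>\<^bsub>R\<^esub>i\<in>A. f i) \<odot>\<^bsub>M\<^esub> x = (\<Oplus>\<^bsub>M\<^esub>i\<in>A. f i \<odot>\<^bsub>M\<^esub> x)"
  using assms
proof (induct set: finite)
  case empty
  then show ?case by simp
next
  case (insert a A)
  then show ?case by (simp add: Pi_def smult_l_distr)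
qed

lemma (in module) smult_pow_image:
  assumes "r \<in> carrier R" "S \<subseteq> carrier M" "(\<lambda>x. r \<odot>\<^bsub>M\<^esub> x) ` S = S"
  shows "(\<lambda>x. (r [^]\<^bsub>R\<^esub> (n::nat)) \<odot>\<^bsub>M\<^esub> x) ` S = S"
proof (induction n)
  case 0
  have "(\<lambda>x. (r [^]\<^bsub>R\<^esub> (0::nat)) \<odot>\<^bsub>M\<^esub> x) ` S = (\<lambda>x. x) ` S"
    using assms(2) by (intro image_cong) auto
  then show ?case by simp
next
  case (Suc n)
  have "(\<lambda>x. (r [^]\<^bsub>R\<^esub> Suc n) \<odot>\<^bsub>M\<^esub> x) ` S
      = (\<lambda>x. (r [^]\<^bsub>R\<^esub> n) \<odot>\<^bsub>M\<^esub> x) ` (\<lambda>x. r \<odot>\<^bsub>M\<^esub> x) ` S"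
    unfolding image_image using assms(1,2) by (intro image_cong) (auto simp: smult_assoc1)
  then show ?case using Suc assms(3) by simp
qed

section \<open>Annihilation tested on homogeneous components\<close>

context graded_module
begin

lemma component_carrier:
  assumes "g \<in> carrier G"
  shows "RG g \<subseteq> carrier R" "MG g \<subseteq> carrier M"
  using assms ring_direct_sum module_direct_sum unfolding internal_direct_sum_def by auto

lemma smult_zero_if_components_smult_zero:
  assumes f: "components_of R (carrier G) RG f r" and x: "x \<in> carrier M"
    and z: "\<And>g. g \<in> carrier G \<Longrightarrow> f g \<odot>\<^bsub>M\<^esub> x = \<zero>\<^bsub>M\<^esub>"
  shows "r \<odot>\<^bsub>M\<^esub> x = \<zero>\<^bsub>M\<^esub>"
proof -
  let ?B = "{g \<in> carrier G. f g \<noteq> \<zero>\<^bsub>R\<^esub>}"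
  have "f \<in> ?B \<rightarrow> carrier R"
    using components_of_mem[OF f] component_carrier by blast
  then have "r \<odot>\<^bsub>M\<^esub> x = (\<Oplus>\<^bsub>M\<^esub>g\<in>?B. f g \<odot>\<^bsub>M\<^esub> x)"
    using f x finsum_smult_rdistr[of ?B f x] unfolding components_of_def by auto
  also have "\<dots> = (\<Oplus>\<^bsub>M\<^esub>g\<in>?B. \<zero>\<^bsub>M\<^esub>)"
    using z by (intro M.finsum_cong') auto
  finally show ?thesis by (simp add: M.finsum_zero)
qed

lemma smult_zero_if_smult_components_zero:
  assumes f: "components_of M (carrier G) MG f x" and r: "r \<in> carrier R"
    and z: "\<And>g. g \<in> carrier G \<Longrightarrow> r \<odot>\<^bsub>M\<^esub> f g = \<zero>\<^bsub>M\<^esub>"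
  shows "r \<odot>\<^bsub>M\<^esub> x = \<zero>\<^bsub>M\<^esub>"
proof -
  let ?B = "{g \<in> carrier G. f g \<noteq> \<zero>\<^bsub>M\<^esub>}"
  have "f \<in> ?B \<rightarrow> carrier M"
    using components_of_mem[OF f] component_carrier by blast
  then have "r \<odot>\<^bsub>M\<^esub> x = (\<Oplus>\<^bsub>M\<^esub>g\<in>?B. r \<odot>\<^bsub>M\<^esub> f g)"
    using f r finsum_smult_ldistr[of ?B r f] unfolding components_of_def by auto
  also have "\<dots> = (\<Oplus>\<^bsub>M\<^esub>g\<in>?B. \<zero>\<^bsub>M\<^esub>)"
    using z by (intro M.finsum_cong') auto
  finally show ?thesis by (simp add: M.finsum_zero)
qed

text \<open>Right translation by \<open>h\<close> is injective on the group, so the products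
  \<open>f g\<close> times \<open>x\<close> sit in pairwise different degrees and cannot cancel. For
  inhomogeneous \<open>x\<close>, terms from different pairs of degrees could meet in one
  degree.\<close>

lemma component_smult_zero:
  assumes f: "components_of R (carrier G) RG f r"
    and h: "h \<in> carrier G" and x: "x \<in> MG h" and rx: "r \<odot>\<^bsub>M\<^esub> x = \<zero>\<^bsub>M\<^esub>"
    and g: "g \<in> carrier G"
  shows "f g \<odot>\<^bsub>M\<^esub> x = \<zero>\<^bsub>M\<^esub>"
proof -
  \<comment> \<open>Both \<open>\<phi>\<close> and the zero family list the components of \<open>r x = 0\<close>.\<close>
  define \<phi> where "\<phi> = (\<lambda>k\<in>carrier G. f (k \<otimes>\<^bsub>G\<^esub> inv\<^bsub>G\<^esub> h) \<odot>\<^bsub>M\<^esub> x)"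
  let ?B = "{g \<in> carrier G. f g \<noteq> \<zero>\<^bsub>R\<^esub>}"
  let ?A = "{k \<in> carrier G. \<phi> k \<noteq> \<zero>\<^bsub>M\<^esub>}"
  let ?t = "\<lambda>g. g \<otimes>\<^bsub>G\<^esub> h"
  have xM: "x \<in> carrier M" using component_carrier h x by blast
  have \<phi>_shift: "\<phi> (?t g) = f g \<odot>\<^bsub>M\<^esub> x" if "g \<in> carrier G" for g
    using that h by (simp add: \<phi>_def G.m_assoc)
  have \<phi>_deg: "\<phi> k \<in> MG k" if k: "k \<in> carrier G" for k
  proof -
    have "f (k \<otimes>\<^bsub>G\<^esub> inv\<^bsub>G\<^esub> h) \<odot>\<^bsub>M\<^esub> x \<in> MG (k \<otimes>\<^bsub>G\<^esub> inv\<^bsub>G\<^esub> h \<otimes>\<^bsub>G\<^esub> h)"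
      using components_of_mem[OF f] k h x by (intro module_degree_smult) auto
    then show ?thesis using k h by (simp add: \<phi>_def G.m_assoc)
  qed
  have fin: "finite ?B" using f unfolding components_of_def by blast
  \<comment> \<open>The inclusion can be strict: a nonzero \<open>f g\<close> may kill
    \<open>x\<close>. So the sum is first carried over to the translate of \<open>?B\<close> and
    then cut down to the support \<open>?A\<close>, the index set that \<open>components_of\<close>
    requires.\<close>
  have sub: "?A \<subseteq> ?t ` ?B"
  proof
    fix k assume k: "k \<in> ?A"
    then have "k = ?t (k \<otimes>\<^bsub>G\<^esub> inv\<^bsub>G\<^esub> h)" using h by (simp add: G.m_assoc)
    moreover have "k \<otimes>\<^bsub>G\<^esub> inv\<^bsub>G\<^esub> h \<in> ?B" using k h xM by (auto simp: \<phi>_def)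
    ultimately show "k \<in> ?t ` ?B" by blast
  qed
  have inj: "inj_on ?t ?B" using h by (auto simp: inj_on_def)
  have "\<phi> \<in> carrier G \<rightarrow> carrier M"
    using \<phi>_deg component_carrier(2) by blast
  moreover have "?t ` ?B \<subseteq> carrier G" using h by auto
  ultimately have tM: "\<phi> \<in> ?t ` ?B \<rightarrow> carrier M" by blast
  have "f \<in> ?B \<rightarrow> carrier R"
    using components_of_mem[OF f] component_carrier by blast
  then have "r \<odot>\<^bsub>M\<^esub> x = (\<Oplus>\<^bsub>M\<^esub>g\<in>?B. f g \<odot>\<^bsub>M\<^esub> x)"
    using f xM finsum_smult_rdistr[of ?B f x] unfolding components_of_def by auto
  also have "\<dots> = (\<Oplus>\<^bsub>M\<^esub>g\<in>?B. \<phi> (?t g))"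
    using \<phi>_shift tM by (intro M.finsum_cong') auto
  also have "\<dots> = (\<Oplus>\<^bsub>M\<^esub>k\<in>?t ` ?B. \<phi> k)"
    using M.finsum_reindex[OF tM inj] by simp
  also have "\<dots> = (\<Oplus>\<^bsub>M\<^esub>k\<in>?A. \<phi> k)"
    using fin sub tM h by (intro M.add.finprod_mono_neutral_cong_right) auto
  finally have "\<zero>\<^bsub>M\<^esub> = (\<Oplus>\<^bsub>M\<^esub>k\<in>?A. \<phi> k)" using rx by simp
  moreover have "\<phi> \<in> (\<Pi>\<^sub>E k\<in>carrier G. MG k)"
    using \<phi>_deg by (simp add: PiE_iff \<phi>_def)
  moreover have "finite ?A" using finite_subset[OF sub] fin by blast
  ultimately have "components_of M (carrier G) MG \<phi> \<zero>\<^bsub>M\<^esub>"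
    unfolding components_of_def by blast
  \<comment> \<open>The zero family has empty support, hence empty sum. Like the first family it is
    restricted to \<open>carrier G\<close>, since \<open>components_of\<close> fixes the value
    \<open>undefined\<close> elsewhere and only then are the two functions equal.\<close>
  moreover have "components_of M (carrier G) MG (\<lambda>k\<in>carrier G. \<zero>\<^bsub>M\<^esub>) \<zero>\<^bsub>M\<^esub>"
  proof -
    have "\<zero>\<^bsub>M\<^esub> \<in> MG k" if "k \<in> carrier G" for k
      using that module_direct_sum additive_subgroup.zero_closed
      unfolding internal_direct_sum_def by blast
    moreover have "{k \<in> carrier G. (\<lambda>k\<in>carrier G. \<zero>\<^bsub>M\<^esub>) k \<noteq> \<zero>\<^bsub>M\<^esub>} = {}" by auto
    ultimately show ?thesis
      unfolding components_of_def by (simp only: M.finsum_empty) auto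
  qed
  ultimately have "\<phi> = (\<lambda>k\<in>carrier G. \<zero>\<^bsub>M\<^esub>)"
    using internal_direct_sum_component_unique[OF module_direct_sum M.zero_closed] by blast
  then show ?thesis using \<phi>_shift[OF g] g h by simp
qed

text \<open>Since \<open>N\<close> is graded, the components of any \<open>x\<close> in
  \<open>N\<close> are again in \<open>N\<close>, so \<open>r\<close> kills each of them. Being
  homogeneous, each is then killed by \<open>f g\<close>, and so is their sum
  \<open>x\<close>.\<close>

lemma component_ann_ring:
  assumes N: "graded_submodule G R M MG N" and r: "r \<in> ann_ring R M N"
    and f: "components_of R (carrier G) RG f r" and g: "g \<in> carrier G"
  shows "f g \<in> ann_ring R M N"
proof -
  have fg: "f g \<in> carrier R" using components_of_mem[OF f g] component_carrier g by blast
  have "f g \<odot>\<^bsub>M\<^esub> x = \<zero>\<^bsub>M\<^esub>" if x: "x \<in> N" for x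
  proof -
    obtain c where c: "components_of M (carrier G) (\<lambda>g. N \<inter> MG g) c x"
      using N x internal_direct_sum_obtain_components unfolding graded_submodule_def by metis
    show ?thesis
    proof (rule smult_zero_if_smult_components_zero[OF _ fg])
      show "components_of M (carrier G) MG c x" by (rule components_of_mono[OF c]) auto
      fix h assume h: "h \<in> carrier G"
      have ch: "c h \<in> N \<inter> MG h" using components_of_mem[OF c h] .
      then show "f g \<odot>\<^bsub>M\<^esub> c h = \<zero>\<^bsub>M\<^esub>"
        using r by (intro component_smult_zero[OF f h _ _ g]) (auto simp: ann_ring_def)
    qed
  qed
  then show ?thesis using fg by (simp add: ann_ring_def)
qed

section \<open>Graded second submodules and annihilators\<close>

lemma graded_second_subset_carrier:
  assumes "graded_second G R RG M MG S"
  shows "S \<subseteq> carrier M"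
  using assms submoduleE(1) unfolding graded_second_def graded_submodule_def by blast

lemma graded_radical_subset_ann_ring:
  assumes S: "graded_second G R RG M MG S" and J: "J \<subseteq> ann_ring R M S"
  shows "graded_radical G R RG J \<subseteq> ann_ring R M S"
proof
  fix a assume "a \<in> graded_radical G R RG J"
  then obtain f where a: "a \<in> carrier R" and f: "components_of R (carrier G) RG f a"
    and nil: "\<And>g. g \<in> carrier G \<Longrightarrow> \<exists>n::nat. n > 0 \<and> f g [^]\<^bsub>R\<^esub> n \<in> J"
    unfolding graded_radical_def by blast
  have SM: "S \<subseteq> carrier M" by (rule graded_second_subset_carrier[OF S])
  \<comment> \<open>Nonemptiness makes the image of \<open>S\<close> under an annihilating power
    exactly the zero submodule rather than the empty set; \<open>S\<close> being nonzero then
    separates that image from \<open>S\<close>.\<close>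
  have "S \<noteq> {}" "S \<noteq> {\<zero>\<^bsub>M\<^esub>}"
    using S submoduleE(2) unfolding graded_second_def graded_submodule_def by blast+
  have zero: "f g \<odot>\<^bsub>M\<^esub> x = \<zero>\<^bsub>M\<^esub>" if g: "g \<in> carrier G" and x: "x \<in> S" for g x
  proof -
    have fg: "f g \<in> RG g" using components_of_mem[OF f g] .
    then have fR: "f g \<in> carrier R" using component_carrier g by blast
    obtain n :: nat where "f g [^]\<^bsub>R\<^esub> n \<in> J" using nil[OF g] by blast
    then have "(\<lambda>x. (f g [^]\<^bsub>R\<^esub> n) \<odot>\<^bsub>M\<^esub> x) ` S = {\<zero>\<^bsub>M\<^esub>}"
      using J \<open>S \<noteq> {}\<close> by (force simp: ann_ring_def)
    then have "(\<lambda>x. f g \<odot>\<^bsub>M\<^esub> x) ` S \<noteq> S"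
      using smult_pow_image[OF fR SM, of n] \<open>S \<noteq> {\<zero>\<^bsub>M\<^esub>}\<close> by auto
    moreover have "f g \<in> homogeneous G RG" using fg g by (auto simp: homogeneous_def)
    ultimately have "(\<lambda>x. f g \<odot>\<^bsub>M\<^esub> x) ` S = {\<zero>\<^bsub>M\<^esub>}"
      using S unfolding graded_second_def by blast
    then show ?thesis using x by blast
  qed
  have "a \<odot>\<^bsub>M\<^esub> x = \<zero>\<^bsub>M\<^esub>" if "x \<in> S" for x
    using smult_zero_if_components_smult_zero[OF f] zero SM that by blast
  then show "a \<in> ann_ring R M S" using a by (simp add: ann_ring_def)
qed

text \<open>Both conditions on \<open>S\<close> say that every product of a scalar in
  \<open>J\<close> with an element of \<open>S\<close> is zero.\<close>

lemma Vs_star_ann_module: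
  assumes "J \<subseteq> carrier R"
  shows "Vs_star G R RG M MG (ann_module M J)
    = {S \<in> second_spec G R RG M MG. J \<subseteq> ann_ring R M S}"
  using assms graded_second_subset_carrier
  unfolding Vs_star_def second_spec_def ann_module_def ann_ring_def by blast

text \<open>The two annihilators form an order-reversing Galois connection: \<open>J\<close> lies in
  its double annihilator, which gives one direction, and taking ring annihilators of
  \<open>S\<close> inside \<open>ann_module M J\<close> gives the other.\<close>

lemma Vs_ann_module:
  assumes "J \<subseteq> carrier R"
  shows "Vs G R RG M MG (ann_module M J)
    = {S \<in> second_spec G R RG M MG. J \<subseteq> ann_ring R M S}"
proof -
  have "ann_ring R M (ann_module M J) \<subseteq> ann_ring R M S \<longleftrightarrow> J \<subseteq> ann_ring R M S"
    if S: "graded_second G R RG M MG S" for S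
  proof
    have "J \<subseteq> ann_ring R M (ann_module M J)"
      using assms by (auto simp: ann_ring_def ann_module_def)
    then show "J \<subseteq> ann_ring R M S" if "ann_ring R M (ann_module M J) \<subseteq> ann_ring R M S"
      using that by blast
  next
    assume "J \<subseteq> ann_ring R M S"
    then have "S \<subseteq> ann_module M J"
      using graded_second_subset_carrier[OF S] by (auto simp: ann_ring_def ann_module_def)
    then show "ann_ring R M (ann_module M J) \<subseteq> ann_ring R M S"
      by (auto simp: ann_ring_def)
  qed
  then show ?thesis unfolding Vs_def second_spec_def by blast
qed

lemma graded_radical_subset_ann_ring_iff:
  assumes "graded_second G R RG M MG S" "J \<subseteq> graded_radical G R RG J"
  shows "graded_radical G R RG J \<subseteq> ann_ring R M S \<longleftrightarrow> J \<subseteq> ann_ring R M S"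
  using assms graded_radical_subset_ann_ring by blast

text \<open>A common normal form for all four sets. The hypothesis covers both a graded ideal and
  the annihilator of a graded submodule, so both halves of the theorem are instances.\<close>

lemma V_ann_module_graded_radical:
  assumes "J \<subseteq> graded_radical G R RG J"
  shows "Vs G R RG M MG (ann_module M J)
      = {S \<in> second_spec G R RG M MG. J \<subseteq> ann_ring R M S}"
    and "Vs G R RG M MG (ann_module M (graded_radical G R RG J))
      = {S \<in> second_spec G R RG M MG. J \<subseteq> ann_ring R M S}"
    and "Vs_star G R RG M MG (ann_module M J)
      = {S \<in> second_spec G R RG M MG. J \<subseteq> ann_ring R M S}"
    and "Vs_star G R RG M MG (ann_module M (graded_radical G R RG J))
      = {S \<in> second_spec G R RG M MG. J \<subseteq> ann_ring R M S}"
proof -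
  have Gr: "graded_radical G R RG J \<subseteq> carrier R" by (auto simp: graded_radical_def)
  then have J: "J \<subseteq> carrier R" using assms by blast
  have eq: "{S \<in> second_spec G R RG M MG. graded_radical G R RG J \<subseteq> ann_ring R M S}
      = {S \<in> second_spec G R RG M MG. J \<subseteq> ann_ring R M S}"
    using graded_radical_subset_ann_ring_iff[OF _ assms] unfolding second_spec_def by blast
  show "Vs G R RG M MG (ann_module M J)
      = {S \<in> second_spec G R RG M MG. J \<subseteq> ann_ring R M S}"
    "Vs G R RG M MG (ann_module M (graded_radical G R RG J))
      = {S \<in> second_spec G R RG M MG. J \<subseteq> ann_ring R M S}"
    "Vs_star G R RG M MG (ann_module M J)
      = {S \<in> second_spec G R RG M MG. J \<subseteq> ann_ring R M S}"
    "Vs_star G R RG M MG (ann_module M (graded_radical G R RG J))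
      = {S \<in> second_spec G R RG M MG. J \<subseteq> ann_ring R M S}"
    by (simp_all add: Vs_ann_module Vs_star_ann_module J Gr eq)
qed

section \<open>The two instances: graded ideals and annihilators of graded submodules\<close>

lemma graded_ideal_subset_graded_radical:
  assumes J: "graded_ideal G R RG J"
  shows "J \<subseteq> graded_radical G R RG J"
proof (rule graded_radical_superset[OF _ _ R.monoid_axioms])
  show JR: "J \<subseteq> carrier R"
    using J ideal.axioms(1) additive_subgroup.a_subset unfolding graded_ideal_def by blast
  fix a assume "a \<in> J"
  then obtain f where f: "components_of R (carrier G) (\<lambda>g. J \<inter> RG g) f a"
    using J internal_direct_sum_obtain_components unfolding graded_ideal_def by metis
  have "components_of R (carrier G) RG f a" by (rule components_of_mono[OF f]) auto
  then show "\<exists>f. components_of R (carrier G) RG f a \<and>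
      (\<forall>g\<in>carrier G. f g \<in> J \<inter> carrier R)"
    using components_of_mem[OF f] JR by blast
qed

lemma ann_ring_subset_graded_radical:
  assumes N: "graded_submodule G R M MG N"
  shows "ann_ring R M N \<subseteq> graded_radical G R RG (ann_ring R M N)"
proof (rule graded_radical_superset[OF _ _ R.monoid_axioms])
  show R: "ann_ring R M N \<subseteq> carrier R" by (auto simp: ann_ring_def)
  fix a assume a: "a \<in> ann_ring R M N"
  then obtain f where "components_of R (carrier G) RG f a"
    using R internal_direct_sum_obtain_components[OF ring_direct_sum] by blast
  then show "\<exists>f. components_of R (carrier G) RG f a \<and>
      (\<forall>g\<in>carrier G. f g \<in> ann_ring R M N \<inter> carrier R)"
    using component_ann_ring[OF N a] R by blast
qed

end

theorem lemma3p5: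
  fixes G :: "('g, 'n) monoid_scheme"
    and R :: "('a, 'm) ring_scheme"
    and RG :: "'g \<Rightarrow> 'a set"
    and M :: "('a, 'b, 'p) module_scheme"
    and MG :: "'g \<Rightarrow> 'b set"
    and N :: "'b set"
    and I :: "'a set"
  assumes "graded_module G R RG M MG"
    and "graded_submodule G R M MG N"
    and "graded_ideal G R RG I"
  shows
    "(Vs G R RG M MG (ann_module M I)
        = Vs G R RG M MG (ann_module M (graded_radical G R RG I)) \<and>
      Vs G R RG M MG (ann_module M (graded_radical G R RG I))
        = Vs_star G R RG M MG (ann_module M I) \<and>
      Vs_star G R RG M MG (ann_module M I)
        = Vs_star G R RG M MG (ann_module M (graded_radical G R RG I)))
     \<and>
     (Vs G R RG M MG N
        = Vs G R RG M MG (ann_module M (ann_ring R M N)) \<and>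
      Vs G R RG M MG (ann_module M (ann_ring R M N))
        = Vs G R RG M MG (ann_module M (graded_radical G R RG (ann_ring R M N))) \<and>
      Vs G R RG M MG (ann_module M (graded_radical G R RG (ann_ring R M N)))
        = Vs_star G R RG M MG (ann_module M (ann_ring R M N)) \<and>
      Vs_star G R RG M MG (ann_module M (ann_ring R M N))
        = Vs_star G R RG M MG (ann_module M (graded_radical G R RG (ann_ring R M N))))"
proof -
  interpret graded_module G R RG M MG by fact
  note I = V_ann_module_graded_radical[OF graded_ideal_subset_graded_radical[OF assms(3)]]
  note N = V_ann_module_graded_radical[OF ann_ring_subset_graded_radical[OF assms(2)]]
  \<comment> \<open>After rewriting to normal forms, only \<open>Vs\<close> of \<open>N\<close>
    itself remains, and its definition is already the normal form for
    \<open>ann_ring R M N\<close>.\<close>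
  show ?thesis unfolding I N by (simp add: Vs_def)
qed

end
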